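(* Let $f^c:[0,1]\times\mathbb{T}^d\times\mathcal D\to\mathbb{R}$ and suppose there is $F^c:[0,1]\times\mathcal D\to\mathbb{R}$ such that, for all $t\in[0,1]$ and $m_1,m_2\in\mathcal D$, $$F^c(t,m_2)-F^c(t,m_1)=\int_0^1\int_{\mathbb{T}^d}f^c(t,x,m_1+s(m_2-m_1))(m_2(x)-m_1(x))\,dx\,ds.$$ For $t\in\mathcal T$, $x\in S$, $m\in\mathcal P(S)$ define $$f(t,x,m)=\frac1{h^d}\int_{B_h(x)}f^c(t\Delta t,y,\mathcal R_h(m))\,dy,\qquad F(t,m)=F^c(t\Delta t,\mathcal R_h(m)).$$ Then, for all $t\in\mathcal T$ and $m_1,m_2\in\mathcal P(S)$, $$F(t,m_2)-F(t,m_1)=\int_0^1\sum_{x\in S}f(t,x,m_1+s(m_2-m_1))(m_2(x)-m_1(x))\,ds.$$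
   Context: $\mathbb{T}^d=\mathbb{R}^d/\mathbb{Z}^d$; $\mathcal D=\{\mu\in L^2(\mathbb{T}^d):\mu\ge0,\int\mu=1\}$. $T,N\in\mathbb{N}_+$, $\Delta t=1/T$, $h=1/N$, $\mathcal T=\{0,\dots,T-1\}$, $S=\{(i_1,\dots,i_d)h:i_j\in\mathbb{Z}/N\mathbb{Z}\}\subset\mathbb{T}^d$, $\mathcal P(S)=\{m:S\to[0,\infty):\sum_Sm=1\}$. For $x\in\mathbb{T}^d$, $B_h(x)=\prod_{i=1}^d[x_i-h/2,x_i+h/2)$; the sets $B_h(x)$, $x\in S$, partition $\mathbb{T}^d$. For $m:S\to\mathbb{R}$, $\mathcal R_h(m):\mathbb{T}^d\to\mathbb{R}$ is given by $\mathcal R_h(m)(y)=m(x)/h^d$ where $x\in S$ is the unique point with $y\in B_h(x)$. All integrals are assumed to be well defined (as holds when $f^c$ is Lipschitz continuous in each of its variables, with the $L^2$-norm in the third one). *)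

theory Defs
  imports "HOL-Analysis.Analysis"
begin

section \<open>The torus\<close>

text \<open>The dimension is \<open>d = CARD('n)\<close>.\<close>

definition torus_rel :: "real ^ 'n \<Rightarrow> real ^ 'n \<Rightarrow> bool" where
  "torus_rel x y \<longleftrightarrow> (\<forall>j. x $ j - y $ j \<in> \<int>)"

lemma equivp_torus_rel: "equivp torus_rel"
proof (rule equivpI)
  show "reflp torus_rel" by (simp add: reflp_def torus_rel_def)
  show "symp torus_rel"
    unfolding symp_def torus_rel_def by (metis Ints_minus minus_diff_eq)
  show "transp torus_rel"
    unfolding transp_def torus_rel_def by (metis Ints_add diff_add_cancel add_diff_eq)
qed

quotient_type (overloaded) 'n torus = "real ^ ('n::finite)" / torus_rel
  morphisms rep_torus torus_proj
  by (rule equivp_torus_rel)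

text \<open>Lebesgue measure on the torus: the image, under the projection, of Lebesgue measure on
  the fundamental domain \<open>[0,1)\<^sup>d\<close>, on which the projection is a bijection.\<close>

definition torus_measure :: "('n::finite) torus measure" where
  "torus_measure = embed_measure (lebesgue_on {x :: real ^ 'n. \<forall>j. 0 \<le> x $ j \<and> x $ j < 1}) torus_proj"


section \<open>Square-integrable functions on the torus, modulo equality almost everywhere\<close>

definition square_integrable :: "(('n::finite) torus \<Rightarrow> real) \<Rightarrow> bool" where
  "square_integrable u \<longleftrightarrow>
     u \<in> borel_measurable torus_measure \<and> integrable torus_measure (\<lambda>x. (u x)\<^sup>2)"

definition torus_L2_rel :: "(('n::finite) torus \<Rightarrow> real) \<Rightarrow> ('n torus \<Rightarrow> real) \<Rightarrow> bool" where
  "torus_L2_rel u v \<longleftrightarrow> square_integrable u \<and> square_integrable v \<and> (AE x in torus_measure. u x = v x)"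

lemma square_integrable_zero: "square_integrable (\<lambda>_. 0)"
  by (simp add: square_integrable_def)

lemma square_integrable_scale:
  assumes "square_integrable u" shows "square_integrable (\<lambda>x. c * u x)"
  using assms unfolding square_integrable_def
  by (auto simp: power_mult_distrib intro: borel_measurable_times)

lemma square_integrable_add:
  assumes u: "square_integrable u" and v: "square_integrable v"
  shows "square_integrable (\<lambda>x. u x + v x)"
proof -
  have [measurable]: "u \<in> borel_measurable torus_measure" "v \<in> borel_measurable torus_measure"
    using u v by (simp_all add: square_integrable_def)
  have "integrable torus_measure (\<lambda>x. 2 * (u x)\<^sup>2 + 2 * (v x)\<^sup>2)"
    using u v by (auto simp: square_integrable_def)
  moreover have "AE x in torus_measure. norm ((u x + v x)\<^sup>2) \<le> norm (2 * (u x)\<^sup>2 + 2 * (v x)\<^sup>2)"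
  proof (rule AE_I2)
    fix x
    have "0 \<le> (u x - v x)\<^sup>2" by simp
    then have "(u x + v x)\<^sup>2 \<le> 2 * (u x)\<^sup>2 + 2 * (v x)\<^sup>2"
      by (simp add: power2_eq_square algebra_simps)
    then show "norm ((u x + v x)\<^sup>2) \<le> norm (2 * (u x)\<^sup>2 + 2 * (v x)\<^sup>2)"
      by simp
  qed
  moreover have "(\<lambda>x. (u x + v x)\<^sup>2) \<in> borel_measurable torus_measure"
    by measurable
  ultimately have "integrable torus_measure (\<lambda>x. (u x + v x)\<^sup>2)"
    using Bochner_Integration.integrable_bound by blast
  moreover have "(\<lambda>x. u x + v x) \<in> borel_measurable torus_measure"
    by measurable
  ultimately show ?thesis by (simp add: square_integrable_def)
qed

lemma part_equivp_torus_L2_rel: "part_equivp torus_L2_rel"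
proof (rule part_equivpI)
  show "\<exists>u. torus_L2_rel u u"
    using square_integrable_zero by (auto simp: torus_L2_rel_def)
  show "symp torus_L2_rel"
    by (auto simp: symp_def torus_L2_rel_def)
  show "transp torus_L2_rel"
    unfolding transp_def torus_L2_rel_def by (auto elim: eventually_elim2)
qed

quotient_type (overloaded) 'n torus_L2 = "('n::finite) torus \<Rightarrow> real" / partial: torus_L2_rel
  morphisms rep_torus_L2 torus_L2_class
  by (rule part_equivp_torus_L2_rel)

lemma torus_L2_rel_scale:
  assumes "torus_L2_rel u u'"
  shows "torus_L2_rel (\<lambda>x. c * u x) (\<lambda>x. c * u' x)"
proof -
  have "AE x in torus_measure. u x = u' x"
    using assms by (simp add: torus_L2_rel_def)
  then have "AE x in torus_measure. c * u x = c * u' x"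
    by eventually_elim simp
  then show ?thesis
    using assms square_integrable_scale unfolding torus_L2_rel_def by blast
qed

lemma torus_L2_rel_add:
  assumes "torus_L2_rel u u'" and "torus_L2_rel v v'"
  shows "torus_L2_rel (\<lambda>x. u x + v x) (\<lambda>x. u' x + v' x)"
proof -
  have "AE x in torus_measure. u x = u' x" "AE x in torus_measure. v x = v' x"
    using assms by (simp_all add: torus_L2_rel_def)
  then have "AE x in torus_measure. u x + v x = u' x + v' x"
    by eventually_elim simp
  then show ?thesis
    using assms square_integrable_add unfolding torus_L2_rel_def by blast
qed

instantiation torus_L2 :: (finite) real_vector
begin

lift_definition zero_torus_L2 :: "'a torus_L2" is "\<lambda>_. 0"
  by (simp add: torus_L2_rel_def square_integrable_zero)

lift_definition plus_torus_L2 :: "'a torus_L2 \<Rightarrow> 'a torus_L2 \<Rightarrow> 'a torus_L2"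
  is "\<lambda>u v x. u x + v x"
  by (rule torus_L2_rel_add)

lift_definition scaleR_torus_L2 :: "real \<Rightarrow> 'a torus_L2 \<Rightarrow> 'a torus_L2"
  is "\<lambda>c u x. c * u x"
  by (rule torus_L2_rel_scale)

definition uminus_torus_L2 :: "'a torus_L2 \<Rightarrow> 'a torus_L2" where
  "uminus_torus_L2 u = (- 1) *\<^sub>R u"

definition minus_torus_L2 :: "'a torus_L2 \<Rightarrow> 'a torus_L2 \<Rightarrow> 'a torus_L2" where
  "minus_torus_L2 u v = u + (- 1) *\<^sub>R v"

instance
proof
  fix a b c :: "'a torus_L2" and r s :: real
  show "a + b + c = a + (b + c)"
    by transfer (simp only: add.assoc torus_L2_rel_add)
  show "a + b = b + a"
    by transfer (subst add.commute, rule torus_L2_rel_add)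
  show "0 + a = a"
    by transfer simp
  show "- a + a = 0"
    unfolding uminus_torus_L2_def
    by transfer (simp add: torus_L2_rel_def square_integrable_zero)
  show "a - b = a + - b"
    by (simp add: uminus_torus_L2_def minus_torus_L2_def)
  show "r *\<^sub>R (a + b) = r *\<^sub>R a + r *\<^sub>R b"
    by transfer (simp only: distrib_left torus_L2_rel_add torus_L2_rel_scale)
  show "(r + s) *\<^sub>R a = r *\<^sub>R a + s *\<^sub>R a"
    by transfer (simp only: distrib_right torus_L2_rel_add torus_L2_rel_scale)
  show "r *\<^sub>R s *\<^sub>R a = (r * s) *\<^sub>R a"
    by transfer (simp only: mult.assoc torus_L2_rel_scale)
  show "1 *\<^sub>R a = a"
    by transfer simp
qed

end

definition prob_densities :: "('n::finite) torus_L2 set" where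
  "prob_densities = {\<mu>. (AE x in torus_measure. 0 \<le> rep_torus_L2 \<mu> x) \<and>
                        (LINT x|torus_measure. rep_torus_L2 \<mu> x) = 1}"


section \<open>The grid with step \<open>h = 1 / N\<close>\<close>

definition grid :: "nat \<Rightarrow> ('n::finite) torus set" where
  "grid N = {torus_proj (\<chi> j. real (i j) / real N) | i :: 'n \<Rightarrow> nat. \<forall>j. i j < N}"

text \<open>Functions on the grid are represented by functions on the whole torus, of which only the
  values on the grid matter.\<close>

definition grid_probs :: "nat \<Rightarrow> (('n::finite) torus \<Rightarrow> real) set" where
  "grid_probs N = {m. (\<forall>x\<in>grid N. 0 \<le> m x) \<and> (\<Sum>x\<in>grid N. m x) = 1}"

text \<open>The half-open cube \<open>B\<^sub>h(x)\<close> around \<open>x\<close>, as a subset of the torus.  Every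
  representative \<open>z\<close> of \<open>x\<close> gives the same set.\<close>

definition cell :: "nat \<Rightarrow> ('n::finite) torus \<Rightarrow> 'n torus set" where
  "cell N x = {torus_proj y | y z. torus_proj z = x \<and>
     (\<forall>j. z $ j - (1 / real N) / 2 \<le> y $ j \<and> y $ j < z $ j + (1 / real N) / 2)}"

definition reconstruct :: "nat \<Rightarrow> (('n::finite) torus \<Rightarrow> real) \<Rightarrow> 'n torus \<Rightarrow> real" where
  "reconstruct N m y = m (THE x. x \<in> grid N \<and> y \<in> cell N x) / (1 / real N) ^ CARD('n)"

text \<open>\<open>\<R>\<^sub>h(m)\<close> as an element of \<open>L\<^sup>2\<close>.\<close>

definition reconstruct_L2 :: "nat \<Rightarrow> (('n::finite) torus \<Rightarrow> real) \<Rightarrow> 'n torus_L2" where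
  "reconstruct_L2 N m = torus_L2_class (reconstruct N m)"

end

theory Submission
  imports Defs
begin

text \<open>
  The discrete identity is the continuous one tested on piecewise constant densities.  The map
  \<open>m \<mapsto> \<R>\<^sub>h(m)\<close> is linear and sends probability vectors on the grid to probability densities on
  the torus (\<open>reconstruct_L2_prob_densities\<close>), so it sends the segment from \<open>m1\<close> to \<open>m2\<close> to the
  segment from \<open>\<R>\<^sub>h(m1)\<close> to \<open>\<R>\<^sub>h(m2)\<close> (\<open>reconstruct_L2_segment\<close>).  The hypothesis on \<open>Fc\<close> can
  therefore be applied to these two densities, and it remains to compute the inner integral for a
  fixed \<open>s\<close>.  There the difference \<open>\<R>\<^sub>h(m2) - \<R>\<^sub>h(m1)\<close> equals \<open>(m2 x - m1 x) / h\<^sup>d\<close> on the cell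
  of \<open>x\<close>, so that the integral splits over the cells, and the average of \<open>fc\<close> over the cell
  of \<open>x\<close> is exactly \<open>f\<close> at \<open>x\<close> (\<open>integral_against_reconstruct_diff\<close>).

  What needs work is the geometry behind this: the cells around the grid points partition the torus,
  and they are measurable sets of measure \<open>h\<^sup>d\<close>.  Both follow from a coordinatewise
  description.  The point of the torus represented by \<open>y\<close> lies in the cell of the grid point with
  index \<open>i\<close> exactly if, for every coordinate, rounding \<open>y\<^sub>j N\<close> to the nearest integer gives \<open>i\<^sub>j\<close>
  modulo \<open>N\<close> (\<open>torus_proj_mem_cell_iff\<close>).  Inside the fundamental domain, a cell
  thus becomes a product of subsets of \<open>[0,1)\<close>, each of length \<open>h\<close>, even when it wraps around the
  boundary of the domain.

  Elements of \<open>L\<^sup>2\<close> are classes of functions, so \<open>\<R>\<^sub>h(m)\<close> and the chosen representative of its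
  class agree only almost everywhere; this suffices under the integral.
\<close>

section \<open>Rounding to the grid in one coordinate\<close>

text \<open>Halves are rounded up, because the cells contain their lower and not their upper faces; the
  remainder modulo \<open>N\<close> makes the index periodic, hence well defined on the circle.\<close>

definition nearest_index :: "nat \<Rightarrow> real \<Rightarrow> nat" where
  "nearest_index N a = nat (\<lfloor>a * real N + 1 / 2\<rfloor> mod int N)"

lemma nearest_index_less: "N > 0 \<Longrightarrow> nearest_index N a < N"
  unfolding nearest_index_def by (simp add: nat_less_iff)

text \<open>The integer \<open>k\<close> accounts for the choice of a representative of the grid point in \<open>\<real>\<close>.\<close>

lemma nearest_index_eq_iff:
  assumes "N > 0" "i < N"
  shows "nearest_index N a = i \<longleftrightarrow>
    (\<exists>k\<in>\<int>. real i / N + k - (1 / real N) / 2 \<le> a \<and> a < real i / N + k + (1 / real N) / 2)"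
proof -
  have "nearest_index N a = i \<longleftrightarrow> \<lfloor>a * real N + 1 / 2\<rfloor> mod int N = int i"
    using assms by (auto simp: nearest_index_def)
  also have "\<dots> \<longleftrightarrow> (\<exists>k. \<lfloor>a * real N + 1 / 2\<rfloor> = int i + k * int N)"
  proof
    assume "\<lfloor>a * real N + 1 / 2\<rfloor> mod int N = int i"
    then have "\<lfloor>a * real N + 1 / 2\<rfloor> = int i + (\<lfloor>a * real N + 1 / 2\<rfloor> div int N) * int N"
      by (metis mod_mult_div_eq mult.commute)
    then show "\<exists>k. \<lfloor>a * real N + 1 / 2\<rfloor> = int i + k * int N" by blast
  qed (use assms in auto)
  also have "\<dots> \<longleftrightarrow> (\<exists>k::int. real i / N + k - (1 / real N) / 2 \<le> a \<and> a < real i / N + k + (1 / real N) / 2)"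
  proof (rule arg_cong[where f = Ex], rule ext)
    fix k :: int
    have "real i / N + k - (1 / real N) / 2 = (real i + k * N - 1 / 2) / N"
      "real i / N + k + (1 / real N) / 2 = (real i + k * N + 1 / 2) / N"
      using assms by (simp_all add: field_simps)
    then show "\<lfloor>a * real N + 1 / 2\<rfloor> = int i + k * int N \<longleftrightarrow>
        real i / N + k - (1 / real N) / 2 \<le> a \<and> a < real i / N + k + (1 / real N) / 2"
      using assms by (simp only: floor_eq_iff pos_divide_le_eq pos_less_divide_eq of_nat_0_less_iff) auto
  qed
  also have "\<dots> \<longleftrightarrow> (\<exists>k\<in>\<int>. real i / N + k - (1 / real N) / 2 \<le> a \<and> a < real i / N + k + (1 / real N) / 2)"
    by (auto elim!: Ints_cases)
  finally show ?thesis .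
qed

lemma nearest_index_shift:
  assumes "N > 0" "a - b \<in> \<int>" shows "nearest_index N a = nearest_index N b"
proof -
  obtain k where "a - b = of_int k" using assms(2) by (auto elim: Ints_cases)
  then have "a * real N + 1 / 2 = (b * real N + 1 / 2) + of_int (k * int N)"
    by (simp add: algebra_simps)
  then show ?thesis unfolding nearest_index_def by (simp only: floor_add_int[symmetric]) simp
qed

text \<open>For \<open>i > 0\<close> the set is one interval around \<open>i / N\<close>.  For \<open>i = 0\<close> the interval around \<open>0\<close>
  wraps around, and its two halves lie at the two ends of \<open>[0,1)\<close>.\<close>

lemma emeasure_nearest_index:
  assumes "N > 0" "i < N"
  shows "emeasure lborel {a. 0 \<le> a \<and> a < 1 \<and> nearest_index N a = i} = ennreal (1 / real N)"
proof (cases "i = 0")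
  case True
  define e where "e = (1 / real N) / 2"
  have e: "0 < e" "e \<le> 1 / 2" "e + e = 1 / real N"
    using assms by (auto simp: e_def field_simps)
  have "nearest_index N a = 0 \<longleftrightarrow> a < e \<or> 1 - e \<le> a" if "0 \<le> a" "a < 1" for a
  proof -
    have "(\<exists>k\<in>\<int>. k - e \<le> a \<and> a < k + e) \<longleftrightarrow> a < e \<or> 1 - e \<le> a"
    proof
      assume "\<exists>k\<in>\<int>. k - e \<le> a \<and> a < k + e"
      then obtain k :: int where k: "k - e \<le> a" "a < k + e"
        by (auto elim!: Ints_cases)
      have "real_of_int k > -1" "real_of_int k < 2" using k that e by linarith+
      then have "k = 0 \<or> k = 1" by linarith
      then show "a < e \<or> 1 - e \<le> a" using k by auto
    next
      assume "a < e \<or> 1 - e \<le> a"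
      then show "\<exists>k\<in>\<int>. k - e \<le> a \<and> a < k + e"
      proof
        assume "a < e"
        then show ?thesis using that e by (intro bexI[of _ 0]) auto
      next
        assume "1 - e \<le> a"
        then show ?thesis using that e by (intro bexI[of _ 1]) auto
      qed
    qed
    then show ?thesis using nearest_index_eq_iff[of N 0 a, folded e_def] assms by simp
  qed
  then have "{a. 0 \<le> a \<and> a < 1 \<and> nearest_index N a = i} = {0..<e} \<union> {1 - e..<1}"
    using True e by auto
  moreover have "{0..<e} \<inter> {1 - e..<1} = {}"
    using e by auto
  ultimately have "emeasure lborel {a. 0 \<le> a \<and> a < 1 \<and> nearest_index N a = i} = ennreal e + ennreal e"
    using e by (simp add: plus_emeasure[symmetric])
  also have "\<dots> = ennreal (1 / real N)"
    using e by (subst ennreal_plus[symmetric]) simp_all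
  finally show ?thesis .
next
  case False
  define c e where "c = real i / real N" and "e = (1 / real N) / 2"
  have ce: "0 < e" "0 < c - e" "c + e < 1" "(c + e) - (c - e) = 1 / real N"
    using False assms by (auto simp: c_def e_def field_simps)
  have key: "nearest_index N a = i \<longleftrightarrow> c - e \<le> a \<and> a < c + e" if a: "0 \<le> a" "a < 1" for a
  proof -
    have "(\<exists>k\<in>\<int>. c + k - e \<le> a \<and> a < c + k + e) \<longleftrightarrow> c - e \<le> a \<and> a < c + e"
    proof
      assume "\<exists>k\<in>\<int>. c + k - e \<le> a \<and> a < c + k + e"
      then obtain k :: int where k: "c + k - e \<le> a" "a < c + k + e"
        by (auto elim!: Ints_cases)
      have "real_of_int k > -1" "real_of_int k < 1" using k a ce by linarith+
      then have "k = 0" by linarith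
      then show "c - e \<le> a \<and> a < c + e" using k by simp
    next
      assume "c - e \<le> a \<and> a < c + e"
      then show "\<exists>k\<in>\<int>. c + k - e \<le> a \<and> a < c + k + e"
        by (intro bexI[of _ 0]) auto
    qed
    then show ?thesis using nearest_index_eq_iff[OF assms, of a, folded c_def e_def] by simp
  qed
  have "{a. 0 \<le> a \<and> a < 1 \<and> nearest_index N a = i} = {c - e..<c + e}"
  proof (rule set_eqI)
    fix a
    show "a \<in> {a. 0 \<le> a \<and> a < 1 \<and> nearest_index N a = i} \<longleftrightarrow> a \<in> {c - e..<c + e}"
      using key[of a] ce by auto
  qed
  then show ?thesis using ce by simp
qed

section \<open>Cells in coordinates\<close>

lemma torus_proj_eq_iff: "torus_proj x = torus_proj y \<longleftrightarrow> (\<forall>j. x $ j - y $ j \<in> \<int>)"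
  by (simp add: torus.abs_eq_iff torus_rel_def)

text \<open>Each coordinate can be treated separately, because a representative of a grid point may be
  shifted by a different integer in each coordinate.\<close>

lemma torus_proj_mem_cell_iff:
  fixes y :: "real ^ 'n::finite"
  assumes "N > 0" "\<forall>j. i j < N"
  shows "torus_proj y \<in> cell N (torus_proj (\<chi> j. real (i j) / real N)) \<longleftrightarrow> (\<forall>j. nearest_index N (y $ j) = i j)"
proof
  assume "torus_proj y \<in> cell N (torus_proj (\<chi> j. real (i j) / real N))"
  then obtain y' z where y': "\<forall>j. y $ j - y' $ j \<in> \<int>" and z: "\<forall>j. z $ j - real (i j) / real N \<in> \<int>"
    and c: "\<forall>j. z $ j - (1 / real N) / 2 \<le> y' $ j \<and> y' $ j < z $ j + (1 / real N) / 2"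
    unfolding cell_def by (auto simp: torus_proj_eq_iff)
  have "nearest_index N (y' $ j) = i j" for j
    using assms c z by (subst nearest_index_eq_iff) (auto intro!: bexI[of _ "z $ j - real (i j) / real N"])
  then show "\<forall>j. nearest_index N (y $ j) = i j"
    using y' nearest_index_shift[OF \<open>N > 0\<close>] by metis
next
  assume "\<forall>j. nearest_index N (y $ j) = i j"
  then have "\<forall>j. \<exists>k\<in>\<int>. real (i j) / N + k - (1 / real N) / 2 \<le> y $ j \<and>
      y $ j < real (i j) / N + k + (1 / real N) / 2"
    using assms by (simp add: nearest_index_eq_iff)
  then obtain k where k: "\<And>j. k j \<in> \<int>" "\<And>j. real (i j) / N + k j - (1 / real N) / 2 \<le> y $ j"
      "\<And>j. y $ j < real (i j) / N + k j + (1 / real N) / 2"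
    by metis
  then show "torus_proj y \<in> cell N (torus_proj (\<chi> j. real (i j) / real N))"
    unfolding cell_def
    by (intro CollectI exI[of _ y] exI[of _ "\<chi> j. real (i j) / N + k j"] conjI refl)
      (simp_all add: torus_proj_eq_iff)
qed

text \<open>The grid point is found by rounding any representative of \<open>y\<close>; it is unique since its index
  is determined by the rounded values.\<close>

lemma ex1_grid_cell:
  assumes "N > 0"
  shows "\<exists>!x. x \<in> grid N \<and> y \<in> cell N x"
proof -
  obtain w where w: "y = torus_proj w" by (metis Quotient3_torus Quotient3_def)
  show ?thesis
  proof (rule ex1I[of _ "torus_proj (\<chi> j. real (nearest_index N (w $ j)) / real N)"])
    show "torus_proj (\<chi> j. real (nearest_index N (w $ j)) / real N) \<in> grid N \<and>
        y \<in> cell N (torus_proj (\<chi> j. real (nearest_index N (w $ j)) / real N))"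
      using assms unfolding w grid_def
      by (subst torus_proj_mem_cell_iff) (auto simp: nearest_index_less)
  next
    fix x assume "x \<in> grid N \<and> y \<in> cell N x"
    then show "x = torus_proj (\<chi> j. real (nearest_index N (w $ j)) / real N)"
      using assms unfolding w grid_def by (auto simp: torus_proj_mem_cell_iff)
  qed
qed

lemma finite_grid: "finite (grid N :: ('n::finite) torus set)"
proof -
  have "grid N = (\<lambda>i::'n \<Rightarrow> nat. torus_proj (\<chi> j. real (i j) / real N)) ` (\<Pi>\<^sub>E j\<in>UNIV. {..<N})"
    unfolding grid_def by (auto simp: PiE_UNIV_domain)
  then show ?thesis by (simp add: finite_PiE)
qed

section \<open>The measure of a cell\<close>

text \<open>Tonelli's theorem: the indicator function of the product set is the product of the indicator
  functions of the coordinates.\<close>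

lemma emeasure_lborel_vec_Times:
  fixes A :: "'n::finite \<Rightarrow> real set"
  assumes [measurable]: "\<And>j. A j \<in> sets borel"
  shows "emeasure lborel {y :: real ^ 'n. \<forall>j. y $ j \<in> A j} = (\<Prod>j\<in>UNIV. emeasure lborel (A j))"
proof -
  define e where "e = (\<lambda>j::'n. axis j (1::real))"
  have Basis: "Basis = range e" and inj: "inj e"
    by (auto simp: e_def Basis_vec_def inj_on_def axis_eq_axis)
  define B where "B = (\<lambda>b. A (inv e b))"
  have B: "B (e j) = A j" for j using inj by (simp add: B_def)
  have "emeasure lborel {y :: real ^ 'n. \<forall>j. y $ j \<in> A j} =
      (\<integral>\<^sup>+y. indicator {y :: real ^ 'n. \<forall>j. y $ j \<in> A j} y \<partial>lborel)"
    by (rule nn_integral_indicator[symmetric]) measurable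
  also have "indicator {y :: real ^ 'n. \<forall>j. y $ j \<in> A j} =
      (\<lambda>y. \<Prod>b\<in>Basis. indicator (B b) (y \<bullet> b) :: ennreal)"
  proof
    fix y :: "real ^ 'n"
    have "(\<Prod>b\<in>Basis. indicator (B b) (y \<bullet> b) :: ennreal) = (\<Prod>j\<in>UNIV. indicator (A j) (y $ j))"
      unfolding Basis by (subst prod.reindex[OF inj]) (simp add: B, simp add: e_def inner_axis)
    also have "\<dots> = indicator {y. \<forall>j. y $ j \<in> A j} y"
      by (auto simp: indicator_def)
    finally show "indicator {y. \<forall>j. y $ j \<in> A j} y = (\<Prod>b\<in>Basis. indicator (B b) (y \<bullet> b) :: ennreal)"
      by simp
  qed
  also have "(\<integral>\<^sup>+y. (\<Prod>b\<in>Basis. indicator (B b) (y \<bullet> b)) \<partial>(lborel :: (real^'n) measure)) =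
      (\<Prod>b\<in>(Basis::(real^'n) set). emeasure lborel (B b))"
    by (subst nn_integral_lborel_prod) (auto simp: B_def)
  also have "\<dots> = (\<Prod>j\<in>UNIV. emeasure lborel (A j))"
    by (simp add: Basis prod.reindex inj B)
  finally show ?thesis .
qed

definition fundamental_domain :: "(real ^ 'n) set" where
  "fundamental_domain = {x. \<forall>j. 0 \<le> x $ j \<and> x $ j < 1}"

lemma inj_on_torus_proj: "inj_on torus_proj fundamental_domain"
proof (rule inj_onI, rule vec_eq_iff[THEN iffD2], rule allI)
  fix x y :: "real ^ 'n" and j
  assume *: "x \<in> fundamental_domain" "y \<in> fundamental_domain" "torus_proj x = torus_proj y"
  then obtain k where "x $ j - y $ j = of_int k" by (auto simp: torus_proj_eq_iff elim!: Ints_cases)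
  moreover have "x $ j - y $ j < 1" "x $ j - y $ j > -1"
    using *(1,2) unfolding fundamental_domain_def by (smt (verit) mem_Collect_eq)+
  ultimately have "k = 0" by linarith
  then show "x $ j = y $ j" using \<open>x $ j - y $ j = of_int k\<close> by simp
qed

lemma torus_proj_fundamental_domain: "torus_proj ` fundamental_domain = (UNIV :: ('n::finite) torus set)"
proof -
  have "y \<in> torus_proj ` fundamental_domain" for y :: "'n torus"
  proof -
    obtain w where w: "y = torus_proj w" by (metis Quotient3_torus Quotient3_def)
    have "y = torus_proj (\<chi> j. frac (w $ j))"
      unfolding w by (simp add: torus_proj_eq_iff frac_def)
    then show ?thesis
      by (auto simp: fundamental_domain_def frac_lt_1)
  qed
  then show ?thesis by auto
qed

lemma torus_measure_eq: "torus_measure = embed_measure (lebesgue_on fundamental_domain) torus_proj"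
  by (simp add: torus_measure_def fundamental_domain_def)

lemma space_torus_measure [simp]: "space torus_measure = UNIV"
  by (simp add: torus_measure_eq space_embed_measure torus_proj_fundamental_domain)

lemma fundamental_domain_borel: "fundamental_domain \<in> sets borel"
  unfolding fundamental_domain_def by measurable

text \<open>Pulled back to the fundamental domain, the cell is a product of one-dimensional sets of
  length \<open>1 / N\<close>.\<close>

lemma
  assumes "N > 0" "x \<in> grid N"
  shows sets_cell: "cell N x \<in> sets torus_measure" (is ?A)
    and emeasure_cell: "emeasure torus_measure (cell N (x :: ('n::finite) torus)) = ennreal ((1 / real N) ^ CARD('n))" (is ?B)
proof -
  obtain i where i: "\<forall>j. i j < N" "x = torus_proj (\<chi> j. real (i j) / real N)"
    using assms(2) by (auto simp: grid_def)
  define C where "C = {y :: real^'n. \<forall>j. y $ j \<in> {a. 0 \<le> a \<and> a < 1 \<and> nearest_index N a = i j}}"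
  have A [measurable]: "{a. 0 \<le> a \<and> a < 1 \<and> nearest_index N a = i j} \<in> sets borel" for j
    unfolding nearest_index_def by measurable
  have cell: "cell N x = torus_proj ` C"
  proof -
    have "cell N x = torus_proj ` (torus_proj -` cell N x \<inter> fundamental_domain)"
    proof safe
      fix y assume "y \<in> cell N x"
      moreover obtain w where "w \<in> fundamental_domain" "y = torus_proj w"
        using torus_proj_fundamental_domain by (metis UNIV_I imageE)
      ultimately show "y \<in> torus_proj ` (torus_proj -` cell N x \<inter> fundamental_domain)" by simp
    qed
    also have "torus_proj -` cell N x \<inter> fundamental_domain = C"
      using i assms unfolding C_def fundamental_domain_def by (auto simp: torus_proj_mem_cell_iff)
    finally show ?thesis .
  qed
  have Cb: "C \<in> sets borel" unfolding C_def by measurable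
  have CQ: "C \<subseteq> fundamental_domain" by (auto simp: C_def fundamental_domain_def)
  have Cl: "C \<in> sets lebesgue" and Ql: "(fundamental_domain :: (real ^ 'n) set) \<in> sets lebesgue"
    using Cb fundamental_domain_borel by (auto intro: sets_completionI_sets)
  have Cs: "C \<in> sets (lebesgue_on fundamental_domain)"
    using Cl CQ Ql by (auto simp: sets_restrict_space_iff)
  show ?A unfolding cell torus_measure_eq by (rule in_sets_embed_measure[OF Cs])
  have "emeasure torus_measure (cell N x) = emeasure (lebesgue_on fundamental_domain) C"
    unfolding cell torus_measure_eq
    by (rule emeasure_embed_measure_image'[OF _ Cs]) (simp add: inj_on_torus_proj)
  also have "\<dots> = emeasure lborel C"
    using Cb CQ Ql by (simp add: emeasure_restrict_space)
  also have "\<dots> = (\<Prod>j\<in>(UNIV::'n set). ennreal (1 / real N))"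
    unfolding C_def by (subst emeasure_lborel_vec_Times[OF A]) (use assms(1) i in \<open>simp add: emeasure_nearest_index\<close>)
  finally show ?B by (simp add: ennreal_power)
qed

section \<open>The reconstruction as a density\<close>

text \<open>Since the cells partition the torus, the reconstruction is a finite linear combination of
  indicator functions; measurability, integrability and the value of its integral are read off
  from this form.\<close>

lemma reconstruct_eq_sum:
  assumes "N > 0"
  shows "reconstruct N m (y :: ('n::finite) torus) =
    (\<Sum>x\<in>grid N. m x / (1 / real N) ^ CARD('n) * indicator (cell N x) y)"
proof -
  obtain x where x: "x \<in> grid N" "y \<in> cell N x" and u: "\<And>x'. x' \<in> grid N \<Longrightarrow> y \<in> cell N x' \<Longrightarrow> x' = x"
    using ex1_grid_cell[OF assms, of y] by blast
  have "(THE x. x \<in> grid N \<and> y \<in> cell N x) = x" using x u by blast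
  moreover have "(\<Sum>x\<in>grid N. m x / (1 / real N) ^ CARD('n) * indicator (cell N x) y) =
      (\<Sum>x'\<in>{x}. m x' / (1 / real N) ^ CARD('n) * indicator (cell N x') y)"
  proof (rule sum.mono_neutral_right[OF finite_grid], use x in blast, rule ballI)
    fix x' assume "x' \<in> grid N - {x}"
    then have "y \<notin> cell N x'" using u by blast
    then show "m x' / (1 / real N) ^ CARD('n) * indicator (cell N x') y = 0" by simp
  qed
  ultimately show ?thesis using x by (simp add: reconstruct_def)
qed

lemma integrable_indicator_cell:
  assumes "N > 0" "x \<in> grid N"
  shows "integrable torus_measure (indicator (cell N x) :: 'n::finite torus \<Rightarrow> real)"
  by (rule integrable_real_indicator[OF sets_cell[OF assms]])
    (simp only: emeasure_cell[OF assms] ennreal_less_top infinity_ennreal_def)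

lemma reconstruct_measurable:
  assumes "N > 0" shows "reconstruct N m \<in> borel_measurable torus_measure"
proof -
  have "(\<lambda>y. reconstruct N m y) \<in> borel_measurable torus_measure"
    unfolding reconstruct_eq_sum[OF assms]
    by (intro borel_measurable_sum borel_measurable_times borel_measurable_const
          borel_measurable_indicator sets_cell assms)
  then show ?thesis by simp
qed

lemma square_integrable_reconstruct:
  assumes "N > 0" shows "square_integrable (reconstruct N m :: ('n::finite) torus \<Rightarrow> real)"
proof -
  \<comment> \<open>The square is constant on the cells too, so it is again a reconstruction.\<close>
  have sq: "(reconstruct N m y)\<^sup>2 = reconstruct N (\<lambda>x. (m x)\<^sup>2 / (1 / real N) ^ CARD('n)) y"
    for y :: "'n torus"
    by (simp add: reconstruct_def power2_eq_square)
  have int: "integrable torus_measure (reconstruct N m' :: 'n torus \<Rightarrow> real)" for m'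
  proof -
    have "integrable torus_measure (\<lambda>y :: 'n torus. reconstruct N m' y)"
      unfolding reconstruct_eq_sum[OF assms]
      by (intro Bochner_Integration.integrable_sum integrable_mult_right integrable_indicator_cell assms)
    then show ?thesis by simp
  qed
  have "integrable torus_measure (\<lambda>y :: 'n torus. (reconstruct N m y)\<^sup>2)"
    unfolding sq by (rule int)
  then show ?thesis
    using reconstruct_measurable[OF assms] by (simp add: square_integrable_def)
qed

lemma integral_reconstruct:
  assumes "N > 0"
  shows "(LINT y|torus_measure. reconstruct N m (y :: ('n::finite) torus)) = (\<Sum>x\<in>grid N. m x)"
proof -
  have "measure torus_measure (cell N x) = (1 / real N) ^ CARD('n)" if "x \<in> grid N" for x :: "'n torus"
    using emeasure_cell[OF assms that] by (simp add: measure_def)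
  then show ?thesis
    unfolding reconstruct_eq_sum[OF assms] using assms
    by (subst Bochner_Integration.integral_sum)
      (auto intro!: integrable_mult_right integrable_indicator_cell sum.cong)
qed

lemma torus_L2_rel_reconstruct:
  "N > 0 \<Longrightarrow> torus_L2_rel (reconstruct N m) (reconstruct N m)"
  by (simp add: torus_L2_rel_def square_integrable_reconstruct)

text \<open>The representative chosen from a class need not be the piecewise constant function itself.\<close>

lemma rep_reconstruct_L2:
  assumes "N > 0"
  shows "AE y in torus_measure. rep_torus_L2 (reconstruct_L2 N m) y = reconstruct N m y"
    and "rep_torus_L2 (reconstruct_L2 N m) \<in> borel_measurable torus_measure"
  using Quotient3_rep_abs[OF Quotient3_torus_L2, OF torus_L2_rel_reconstruct[OF assms, of m]]
  by (auto simp: torus_L2_rel_def square_integrable_def reconstruct_L2_def)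

text \<open>The vector space operations on classes may be computed on the piecewise constant
  representatives, on which reconstruction is visibly linear.\<close>

lemma reconstruct_L2_segment:
  assumes "N > 0"
  shows "reconstruct_L2 N m1 + s *\<^sub>R (reconstruct_L2 N m2 - reconstruct_L2 N m1) =
    reconstruct_L2 N (\<lambda>z. m1 z + s * (m2 z - m1 z))"
proof -
  have rel: "torus_L2_rel (reconstruct N m) (reconstruct N m)" for m
    by (rule torus_L2_rel_reconstruct[OF assms])
  have scale: "c *\<^sub>R reconstruct_L2 N m = reconstruct_L2 N (\<lambda>z. c * m z)" for c m
    unfolding reconstruct_L2_def
    by (subst scaleR_torus_L2.abs_eq[OF rel]) (simp add: reconstruct_def [abs_def])
  have add: "reconstruct_L2 N m + reconstruct_L2 N m' = reconstruct_L2 N (\<lambda>z. m z + m' z)" for m m'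
    unfolding reconstruct_L2_def
    by (subst plus_torus_L2.abs_eq[OF rel rel]) (simp add: reconstruct_def [abs_def] add_divide_distrib)
  show ?thesis
    by (simp add: minus_torus_L2_def scale add algebra_simps)
qed

lemma reconstruct_L2_prob_densities:
  assumes "N > 0" "m \<in> grid_probs N"
  shows "reconstruct_L2 N (m :: ('n::finite) torus \<Rightarrow> real) \<in> prob_densities"
proof -
  have "reconstruct N m y \<ge> 0" for y
    unfolding reconstruct_eq_sum[OF assms(1)]
    using assms by (intro sum_nonneg mult_nonneg_nonneg divide_nonneg_nonneg) (auto simp: grid_probs_def)
  then have "AE y in torus_measure. 0 \<le> rep_torus_L2 (reconstruct_L2 N m) y"
    using rep_reconstruct_L2(1)[OF assms(1), of m] by (auto elim: eventually_mono)
  moreover have "(LINT y|torus_measure. rep_torus_L2 (reconstruct_L2 N m) y) = 1"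
    using integral_cong_AE[OF rep_reconstruct_L2(2) reconstruct_measurable rep_reconstruct_L2(1), OF assms(1) assms(1) assms(1), of m]
      integral_reconstruct[OF assms(1), of m] assms by (simp add: grid_probs_def)
  ultimately show ?thesis by (simp add: prob_densities_def)
qed

lemma grid_probs_segment:
  assumes "m1 \<in> grid_probs N" "m2 \<in> grid_probs N" "s \<in> {0..1}"
  shows "(\<lambda>z. m1 z + s * (m2 z - m1 z)) \<in> grid_probs N"
proof -
  have "m1 z + s * (m2 z - m1 z) = (1 - s) * m1 z + s * m2 z" for z
    by (simp add: algebra_simps)
  then show ?thesis
    using assms by (auto simp: grid_probs_def sum.distrib sum_distrib_left[symmetric])
qed

section \<open>Transfer of the derivative formula\<close>

text \<open>The integral splits over the cells, on each of which the difference of the two densities is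
  constant.  The integrability of \<open>g\<close> on the single cells allows the finite sum to be exchanged with
  the integral; measurability is assumed for the chosen representatives, which are known only up to
  null sets.\<close>

lemma integral_against_reconstruct_diff:
  fixes g :: "('n::finite) torus \<Rightarrow> real"
  assumes "N > 0"
    and g: "\<And>x. x \<in> grid N \<Longrightarrow> set_integrable torus_measure (cell N x) g"
    and meas: "(\<lambda>y. g y * (rep_torus_L2 (reconstruct_L2 N m2) y - rep_torus_L2 (reconstruct_L2 N m1) y))
      \<in> borel_measurable torus_measure"
  shows "(LINT y|torus_measure. g y * (rep_torus_L2 (reconstruct_L2 N m2) y - rep_torus_L2 (reconstruct_L2 N m1) y))
    = (\<Sum>x\<in>grid N. 1 / (1 / real N) ^ CARD('n) * (LINT y:cell N x|torus_measure. g y) * (m2 x - m1 x))"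
proof -
  define c where "c x = (m2 x - m1 x) / (1 / real N) ^ CARD('n)" for x
  have step: "g y * (reconstruct N m2 y - reconstruct N m1 y) =
      (\<Sum>x\<in>grid N. c x * (indicator (cell N x) y *\<^sub>R g y))" for y
    unfolding reconstruct_eq_sum[OF assms(1)] c_def sum_subtractf[symmetric] sum_distrib_left
    by (intro sum.cong refl) (simp add: algebra_simps diff_divide_distrib)
  have int: "integrable torus_measure (\<lambda>y. c x * (indicator (cell N x) y *\<^sub>R g y))" if "x \<in> grid N" for x
    using g[OF that] unfolding set_integrable_def by (rule integrable_mult_right)
  have "AE y in torus_measure. g y * (rep_torus_L2 (reconstruct_L2 N m2) y - rep_torus_L2 (reconstruct_L2 N m1) y)
      = (\<Sum>x\<in>grid N. c x * (indicator (cell N x) y *\<^sub>R g y))"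
    using rep_reconstruct_L2(1)[OF assms(1), of m1] rep_reconstruct_L2(1)[OF assms(1), of m2]
    by eventually_elim (simp only: step)
  then have "(LINT y|torus_measure. g y * (rep_torus_L2 (reconstruct_L2 N m2) y - rep_torus_L2 (reconstruct_L2 N m1) y))
      = (LINT y|torus_measure. (\<Sum>x\<in>grid N. c x * (indicator (cell N x) y *\<^sub>R g y)))"
    by (intro integral_cong_AE meas borel_measurable_sum borel_measurable_integrable int) auto
  also have "\<dots> = (\<Sum>x\<in>grid N. c x * (LINT y:cell N x|torus_measure. g y))"
    unfolding set_lebesgue_integral_def
    by (subst Bochner_Integration.integral_sum[OF int]) (simp_all only: integral_mult_right_zero)
  also have "\<dots> = (\<Sum>x\<in>grid N. 1 / (1 / real N) ^ CARD('n) * (LINT y:cell N x|torus_measure. g y) * (m2 x - m1 x))"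
    by (simp add: c_def mult.commute)
  finally show ?thesis .
qed

theorem lemma4p4:
  fixes fc :: "real \<Rightarrow> ('n::finite) torus \<Rightarrow> 'n torus_L2 \<Rightarrow> real"
    and Fc :: "real \<Rightarrow> 'n torus_L2 \<Rightarrow> real"
    and T N :: nat
    and \<Delta>t h :: real
    and f :: "nat \<Rightarrow> 'n torus \<Rightarrow> ('n torus \<Rightarrow> real) \<Rightarrow> real"
    and F :: "nat \<Rightarrow> ('n torus \<Rightarrow> real) \<Rightarrow> real"
  assumes "T > 0" and "N > 0"
    and "\<Delta>t = 1 / real T" and "h = 1 / real N"
    \<comment> \<open>the integrals in the hypothesis on \<open>Fc\<close> and in the definition of \<open>f\<close> are well defined\<close>
    and integrable_x: "\<And>t s m1 m2. \<lbrakk>t \<in> {0..1}; s \<in> {0..1}; m1 \<in> prob_densities; m2 \<in> prob_densities\<rbrakk> \<Longrightarrow>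
      integrable torus_measure
        (\<lambda>x. fc t x (m1 + s *\<^sub>R (m2 - m1)) * (rep_torus_L2 m2 x - rep_torus_L2 m1 x))"
    and integrable_s: "\<And>t m1 m2. \<lbrakk>t \<in> {0..1}; m1 \<in> prob_densities; m2 \<in> prob_densities\<rbrakk> \<Longrightarrow>
      set_integrable lebesgue {0..1}
        (\<lambda>s. LINT x|torus_measure.
           fc t x (m1 + s *\<^sub>R (m2 - m1)) * (rep_torus_L2 m2 x - rep_torus_L2 m1 x))"
    and integrable_cell: "\<And>t x m. \<lbrakk>t < T; x \<in> grid N; m \<in> grid_probs N\<rbrakk> \<Longrightarrow>
      set_integrable torus_measure (cell N x) (\<lambda>y. fc (real t * \<Delta>t) y (reconstruct_L2 N m))"
    and Fc: "\<And>t m1 m2. \<lbrakk>t \<in> {0..1}; m1 \<in> prob_densities; m2 \<in> prob_densities\<rbrakk> \<Longrightarrow>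
      Fc t m2 - Fc t m1 =
        (LINT s:{0..1}|lebesgue. (LINT x|torus_measure.
           fc t x (m1 + s *\<^sub>R (m2 - m1)) * (rep_torus_L2 m2 x - rep_torus_L2 m1 x)))"
    and f: "\<And>t x m. \<lbrakk>t < T; x \<in> grid N; m \<in> grid_probs N\<rbrakk> \<Longrightarrow>
      f t x m = 1 / h ^ CARD('n) *
        (LINT y:cell N x|torus_measure. fc (real t * \<Delta>t) y (reconstruct_L2 N m))"
    and F: "\<And>t m. \<lbrakk>t < T; m \<in> grid_probs N\<rbrakk> \<Longrightarrow> F t m = Fc (real t * \<Delta>t) (reconstruct_L2 N m)"
  shows "\<forall>t<T. \<forall>m1\<in>grid_probs N. \<forall>m2\<in>grid_probs N.
    F t m2 - F t m1 =
      (LINT s:{0..1}|lebesgue. (\<Sum>x\<in>grid N.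
         f t x (\<lambda>z. m1 z + s * (m2 z - m1 z)) * (m2 x - m1 x)))"
proof (intro allI impI ballI)
  fix t :: nat and m1 m2 :: "'n torus \<Rightarrow> real"
  assume t: "t < T" and m: "m1 \<in> grid_probs N" "m2 \<in> grid_probs N"
  note N = \<open>N > 0\<close>
  let ?t = "real t * \<Delta>t" and ?R = "\<lambda>m. reconstruct_L2 N m :: 'n torus_L2"
  have t01: "?t \<in> {0..1}" using t \<open>T > 0\<close> \<open>\<Delta>t = 1 / real T\<close> by simp
  have R: "?R m1 \<in> prob_densities" "?R m2 \<in> prob_densities"
    using m reconstruct_L2_prob_densities[OF N] by auto
  have "(LINT x|torus_measure. fc ?t x (?R m1 + s *\<^sub>R (?R m2 - ?R m1)) *
          (rep_torus_L2 (?R m2) x - rep_torus_L2 (?R m1) x)) =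
      (\<Sum>x\<in>grid N. f t x (\<lambda>z. m1 z + s * (m2 z - m1 z)) * (m2 x - m1 x))"
    if s: "s \<in> {0..1}" for s
  proof -
    let ?m = "\<lambda>z. m1 z + s * (m2 z - m1 z)"
    have ms: "?m \<in> grid_probs N" by (rule grid_probs_segment[OF m s])
    show ?thesis
      unfolding reconstruct_L2_segment[OF N]
      using integral_against_reconstruct_diff[OF N integrable_cell[OF t _ ms]
          borel_measurable_integrable[OF integrable_x[OF t01 s R, unfolded reconstruct_L2_segment[OF N]]]]
      by (simp add: f[OF t _ ms] \<open>h = 1 / real N\<close>)
  qed
  then have "(LINT s:{0..1}|lebesgue. (LINT x|torus_measure. fc ?t x (?R m1 + s *\<^sub>R (?R m2 - ?R m1)) *
          (rep_torus_L2 (?R m2) x - rep_torus_L2 (?R m1) x))) =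
      (LINT s:{0..1}|lebesgue. (\<Sum>x\<in>grid N. f t x (\<lambda>z. m1 z + s * (m2 z - m1 z)) * (m2 x - m1 x)))"
    by (intro set_lebesgue_integral_cong) auto
  then show "F t m2 - F t m1 =
      (LINT s:{0..1}|lebesgue. (\<Sum>x\<in>grid N. f t x (\<lambda>z. m1 z + s * (m2 z - m1 z)) * (m2 x - m1 x)))"
    by (simp add: F[OF t m(1)] F[OF t m(2)] Fc[OF t01 R])
qed

end
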